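(* Let $G$ be a connected graph of order $n\geq 3$. Then the following are equivalent: (1) $sdiam_3(G)=2$; (2) $0\leq \Delta(\overline{G})\leq 1$; (3) $n-2\leq \delta(G)\leq n-1$.
   Context: All graphs are finite, simple and undirected; $\overline{G}$ denotes the complement of $G$, and $\Delta$, $\delta$ denote maximum and minimum degree. For a graph $G$ and $S\subseteq V(G)$ with $|S|\geq 2$, the Steiner distance $d_G(S)$ is the minimum number of edges of a connected subgraph (equivalently, a tree) of $G$ whose vertex set contains $S$; $d_G(S)=\infty$ if no such subgraph exists. For $2\leq k\leq n$ and $v\in V(G)$, the Steiner $k$-eccentricity is $e_k(v)=\max\{d_G(S): S\subseteq V(G), |S|=k, v\in S\}$, and the Steiner $k$-diameter is $sdiam_k(G)=\max\{e_k(v): v\in V(G)\}$, i.e. the maximum of $d_G(S)$ over all $k$-subsets $S$ of $V(G)$. *)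

theory Defs
  imports "Graph_Theory.Digraph_Component" "HOL-Library.Extended_Nat"
begin

(* A finite simple undirected graph is a pair_graph: finite vertex set, no loops, symmetric arc
   relation.  Every undirected edge {u, v} is thus represented by the two arcs (u, v) and (v, u). *)

definition edges :: "'a pair_pre_digraph \<Rightarrow> 'a set set" where
  "edges G = (\<lambda>(u, v). {u, v}) ` parcs G"

definition complement :: "'a pair_pre_digraph \<Rightarrow> 'a pair_pre_digraph" where
  "complement G =
     \<lparr> pverts = pverts G,
       parcs = {(u, v). u \<in> pverts G \<and> v \<in> pverts G \<and> u \<noteq> v \<and> (u, v) \<notin> parcs G} \<rparr>"

(* Each neighbour of v contributes exactly one arc leaving v, so the degree is the out-degree. *)

definition degree :: "'a pair_pre_digraph \<Rightarrow> 'a \<Rightarrow> nat" where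
  "degree G v = out_degree (with_proj G) v"

definition max_degree :: "'a pair_pre_digraph \<Rightarrow> nat" where
  "max_degree G = Max (degree G ` pverts G)"

definition min_degree :: "'a pair_pre_digraph \<Rightarrow> nat" where
  "min_degree G = Min (degree G ` pverts G)"

(* The infimum of the empty set in enat is \<infinity>; that of a nonempty set is attained. *)

definition steiner_distance :: "'a pair_pre_digraph \<Rightarrow> 'a set \<Rightarrow> enat" where
  "steiner_distance G S =
     Inf {enat (card (edges H)) | H.
            pair_graph H \<and> subgraph (with_proj H) (with_proj G) \<and>
            Digraph_Component.connected (with_proj H) \<and> S \<subseteq> pverts H}"

(* The maxima are over finite nonempty sets whenever G is finite, v is a vertex of G and
   1 \<le> k \<le> card (pverts G). *)

definition steiner_eccentricity :: "'a pair_pre_digraph \<Rightarrow> nat \<Rightarrow> 'a \<Rightarrow> enat" where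
  "steiner_eccentricity G k v =
     Max {steiner_distance G S | S. S \<subseteq> pverts G \<and> card S = k \<and> v \<in> S}"

definition steiner_diameter :: "'a pair_pre_digraph \<Rightarrow> nat \<Rightarrow> enat" where
  "steiner_diameter G k = Max (steiner_eccentricity G k ` pverts G)"

end

theory Submission
  imports Defs
begin

text \<open>
  A connected graph containing three given vertices has at least two edges, and if it has exactly
  two then it is a path on these vertices. Hence \<open>sdiam\<^sub>3(G) = 2\<close> says that every three vertices
  contain one adjacent to the other two. A vertex with two non-neighbours violates this; conversely,
  if every vertex has at most one non-neighbour, then of three vertices either one is adjacent to
  the other two, or two of them are non-adjacent and the third is adjacent to both.
\<close>

section \<open>Connected subgraphs spanning three vertices\<close>

lemma connected_cut_arc:
  assumes H: "pair_graph H" and conn: "Digraph_Component.connected (with_proj H)"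
    and u: "u \<in> A" "u \<in> pverts H" and v: "v \<notin> A" "v \<in> pverts H"
  obtains x y where "(x, y) \<in> parcs H" "x \<in> A" "y \<notin> A"
proof -
  interpret pair_graph H by (rule H)
  \<comment> \<open>\<open>connected\<close> refers to the symmetric closure; since H is already
    symmetric, it yields directed reachability in H itself.\<close>
  have "strongly_connected (with_proj H)"
    using conn sym_arcs by (rule symmetric_connected_imp_strongly_connected[rotated])
  then have "u \<rightarrow>\<^sup>*\<^bsub>with_proj H\<^esub> v"
    using u v by (auto simp: strongly_connected_def)
  \<comment> \<open>Follow a walk from \<open>u\<close>: either it is still in \<open>A\<close>, or
    some arc has already left \<open>A\<close>.\<close>
  then have "v \<in> A \<or> (\<exists>x y. (x, y) \<in> parcs H \<and> x \<in> A \<and> y \<notin> A)"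
    by (induction rule: reachable_induct) (use u in auto)
  then show thesis using v that by blast
qed

lemma finite_edges:
  assumes "pair_graph H" shows "finite (edges H)"
proof -
  interpret pair_graph H by (rule assms)
  show ?thesis using pair_finite_arcs by (simp add: edges_def)
qed

text \<open>A set of at most two vertices cannot cover \<open>S\<close>, so by connectedness some
  arc leaves it. Applied to \<open>{a}\<close> and then to \<open>{a, x}\<close>, this produces two
  distinct edges that share the vertex \<open>y\<close>. If there are no others, they form a path
  with middle vertex \<open>y\<close>, and its three vertices must be \<open>S\<close>.\<close>

lemma connected_three_vertices:
  assumes H: "pair_graph H" and conn: "Digraph_Component.connected (with_proj H)"
    and S: "S \<subseteq> pverts H" "card S = 3"
  shows connected_three_vertices_edges: "2 \<le> card (edges H)"
    and connected_two_edges_center: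
      "card (edges H) \<le> 2 \<Longrightarrow> \<exists>y\<in>S. \<forall>w\<in>S - {y}. (y, w) \<in> parcs H"
proof -
  interpret pair_graph H by (rule H)
  have nsub: "\<not> S \<subseteq> T" if "finite T" "card T \<le> 2" for T
    using that S card_mono[of T S] by linarith
  have out: "\<exists>x y. (x, y) \<in> parcs H \<and> x \<in> T \<and> y \<notin> T"
    if T: "finite T" "card T \<le> 2" and a: "a \<in> T" "a \<in> pverts H" for T a
  proof -
    obtain v where "v \<in> S" "v \<notin> T" using nsub[OF T] by blast
    then show ?thesis using connected_cut_arc[OF H conn a, of v] S by blast
  qed
  obtain a where "a \<in> S" using S by fastforce
  then have a: "a \<in> pverts H" using S by blast
  obtain x where ax: "(a, x) \<in> parcs H" using out[of "{a}" a] a by fastforce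
  obtain y z where yz: "(y, z) \<in> parcs H" "y \<in> {a, x}" "z \<notin> {a, x}"
  proof -
    have "card {a, x} \<le> 2" by (simp add: card_insert_if)
    then show thesis using out[of "{a, x}" a] a that by blast
  qed
  \<comment> \<open>The two edges differ because \<open>z\<close> lies outside
    \<open>{a, x}\<close>.\<close>
  have two: "{{a, x}, {y, z}} \<subseteq> edges H" "card {{a, x}, {y, z}} = 2"
    using ax yz by (force simp: edges_def) (use yz in \<open>auto simp: doubleton_eq_iff\<close>)
  show "2 \<le> card (edges H)"
    using card_mono[OF finite_edges[OF H] two(1)] two(2) by simp
  assume "card (edges H) \<le> 2"
  then have edges: "edges H = {{a, x}, {y, z}}"
    using card_seteq[OF finite_edges[OF H] two(1)] two(2) by simp
  \<comment> \<open>An arc also leaves \<open>{v}\<close>, so \<open>v\<close> is an end of one of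
    the only two edges.\<close>
  have "v \<in> {a, x, z}" if "v \<in> S" for v
  proof -
    obtain w where "(v, w) \<in> parcs H" using out[of "{v}" v] \<open>v \<in> S\<close> S(1) by fastforce
    then have "{v, w} \<in> edges H" by (force simp: edges_def)
    then have "v \<in> {a, x} \<union> {y, z}" unfolding edges by blast
    then show ?thesis using yz(2) by blast
  qed
  moreover have "card {a, x, z} = 3"
    using no_loops'[OF ax] yz(3) by (auto simp: card_insert_if)
  ultimately have "S = {a, x, z}"
    using card_seteq[of "{a, x, z}" S] S by auto
  then show "\<exists>y\<in>S. \<forall>w\<in>S - {y}. (y, w) \<in> parcs H"
    using ax yz(1,2) arcs_symmetric[OF ax] by auto
qed

text \<open>The star centred at \<open>y\<close> with leaves \<open>S - {y}\<close> is the witness;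
  it bounds the Steiner distance from above.\<close>

lemma star_subgraph:
  assumes G: "pair_graph G" and S: "S \<subseteq> pverts G" "y \<in> S"
    and adj: "\<forall>w\<in>S - {y}. (y, w) \<in> parcs G"
  obtains H where "pair_graph H" "subgraph (with_proj H) (with_proj G)"
    "Digraph_Component.connected (with_proj H)" "S \<subseteq> pverts H"
    "card (edges H) \<le> card S - 1"
proof -
  interpret G: pair_graph G by (rule G)
  define H where "H = \<lparr>pverts = S, parcs = (\<lambda>w. (y, w)) ` (S - {y}) \<union> (\<lambda>w. (w, y)) ` (S - {y})\<rparr>"
  have finS: "finite S" using S G.pair_finite_verts finite_subset by blast
  have H: "pair_graph H"
    using S finS by unfold_locales (auto simp: H_def symmetric_def sym_def)
  interpret H: pair_graph H by (rule H)
  \<comment> \<open>The two opposite arcs between \<open>y\<close> and \<open>w\<close> collapse to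
    one edge, so each leaf is counted once.\<close>
  have "edges H = (\<lambda>w. {y, w}) ` (S - {y})"
    by (auto simp: edges_def H_def image_Un image_image insert_commute)
  then have "card (edges H) \<le> card S - 1"
    using card_image_le[of "S - {y}" "\<lambda>w. {y, w}"] finS S by simp
  moreover have "subgraph (with_proj H) (with_proj G)"
    using S adj G.arcs_symmetric G.wf_digraph H.wf_digraph
    by (intro subgraphI compatibleI_with_proj) (auto simp: H_def)
  moreover have "Digraph_Component.connected (with_proj H)"
  proof (rule H.connectedI)
    show "pverts H \<noteq> {}" using S by (auto simp: H_def)
    have yr: "y \<rightarrow>\<^sup>*\<^bsub>with_proj H\<^esub> v" if "v \<in> S" for v
    proof (cases "v = y")
      case True
      then show ?thesis using S by (simp, intro H.reachable_refl) (simp add: H_def)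
    next
      case False
      then show ?thesis using that by (intro H.reachable_adjI) (simp add: H_def)
    qed
    fix u v assume "u \<in> pverts H" "v \<in> pverts H"
    \<comment> \<open>Route through the centre: from \<open>u\<close> to \<open>y\<close> by
      symmetry, then from \<open>y\<close> to \<open>v\<close>.\<close>
    then have "u \<rightarrow>\<^sup>*\<^bsub>with_proj H\<^esub> v"
      using yr H.symmetric_reachable' H.reachable_trans by (metis H_def pair_pre_digraph.select_convs(1))
    then show "u \<rightarrow>\<^sup>*\<^bsub>with_proj (mk_symmetric (with_proj H))\<^esub> v"
      by (rule H.reachable_mk_symmetricI)
  qed
  ultimately show thesis using that[OF H] by (simp add: H_def)
qed

section \<open>Steiner distance of three vertices\<close>

lemma steiner_distance_le_enat_iff:
  "steiner_distance G S \<le> enat k \<longleftrightarrow>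
     (\<exists>H. pair_graph H \<and> subgraph (with_proj H) (with_proj G) \<and>
       Digraph_Component.connected (with_proj H) \<and> S \<subseteq> pverts H \<and> card (edges H) \<le> k)"
proof -
  \<comment> \<open>A strict upper bound on an infimum is witnessed by a member of the set, whereas
    a weak one in general is not.\<close>
  have "x \<le> enat k \<longleftrightarrow> x < enat (Suc k)" for x
    by (cases x) auto
  then show ?thesis
    unfolding steiner_distance_def by (auto simp: Inf_less_iff less_Suc_eq_le)
qed

lemma steiner_distance_three_ge:
  assumes "card S = 3"
  shows "2 \<le> steiner_distance G S"
  unfolding steiner_distance_def
  using connected_three_vertices_edges[OF _ _ _ assms]
  by (auto intro!: Inf_greatest simp: numeral_eq_enat)

lemma steiner_distance_three_le_iff:
  assumes G: "pair_graph G" and S: "S \<subseteq> pverts G" "card S = 3"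
  shows "steiner_distance G S \<le> 2 \<longleftrightarrow> (\<exists>y\<in>S. \<forall>w\<in>S - {y}. (y, w) \<in> parcs G)"
proof -
  have two: "(2 :: enat) = enat 2" by (simp add: numeral_eq_enat)
  show ?thesis
    unfolding two steiner_distance_le_enat_iff
  proof
    assume "\<exists>H. pair_graph H \<and> subgraph (with_proj H) (with_proj G) \<and>
       Digraph_Component.connected (with_proj H) \<and> S \<subseteq> pverts H \<and> card (edges H) \<le> 2"
    then obtain H where H: "pair_graph H" "subgraph (with_proj H) (with_proj G)"
      "Digraph_Component.connected (with_proj H)" "S \<subseteq> pverts H" "card (edges H) \<le> 2"
      by blast
    then show "\<exists>y\<in>S. \<forall>w\<in>S - {y}. (y, w) \<in> parcs G"
      using connected_two_edges_center[OF H(1,3,4) S(2) H(5)] by (fastforce elim!: subgraphE)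
  next
    assume "\<exists>y\<in>S. \<forall>w\<in>S - {y}. (y, w) \<in> parcs G"
    then show "\<exists>H. pair_graph H \<and> subgraph (with_proj H) (with_proj G) \<and>
       Digraph_Component.connected (with_proj H) \<and> S \<subseteq> pverts H \<and> card (edges H) \<le> 2"
      using star_subgraph[OF G S(1)] S(2) by (metis add_diff_cancel_right' numeral_3_eq_3 numeral_2_eq_2 diff_Suc_1)
  qed
qed

section \<open>Steiner diameter as a single maximum\<close>

lemma steiner_diameter_eq:
  assumes fin: "finite (pverts G)" and k: "1 \<le> k" "k \<le> card (pverts G)"
  shows "steiner_diameter G k = Max (steiner_distance G ` {S. S \<subseteq> pverts G \<and> card S = k})"
    (is "_ = Max (?d ` ?T)")
proof -
  let ?E = "\<lambda>v. ?d ` {S \<in> ?T. v \<in> S}"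
  have ecc: "steiner_eccentricity G k v = Max (?E v)" for v
    unfolding steiner_eccentricity_def by (rule arg_cong[of _ _ Max]) auto
  have finT: "finite ?T" using fin by simp
  \<comment> \<open>\<open>Max\<close> has no useful value on the empty set, so each
    \<open>v\<close> is extended to a \<open>k\<close>-set by \<open>k - 1\<close> further
    vertices.\<close>
  have ne: "?E v \<noteq> {}" if "v \<in> pverts G" for v
  proof -
    have "k - 1 \<le> card (pverts G - {v})" using k that fin by simp
    then obtain T where T: "T \<subseteq> pverts G - {v}" "card T = k - 1" "finite T"
      using obtain_subset_with_card_n by blast
    then have "card (insert v T) = k" using k by (subst card_insert_disjoint) auto
    with T have "insert v T \<in> {S \<in> ?T. v \<in> S}" using that by auto
    then show ?thesis by blast
  qed
  have V: "pverts G \<noteq> {}" using k by auto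
  have T_ne: "?d ` ?T \<noteq> {}" using V ne by blast
  \<comment> \<open>The two maxima have the same upper bounds: the nested one ranges over the sets
    that contain some vertex, and for \<open>k\<close> at least 1 these are all the
    \<open>k\<close>-sets.\<close>
  have le_iff: "steiner_diameter G k \<le> x \<longleftrightarrow> Max (?d ` ?T) \<le> x" for x
  proof -
    have "steiner_diameter G k \<le> x \<longleftrightarrow> (\<forall>v\<in>pverts G. \<forall>S\<in>{S \<in> ?T. v \<in> S}. ?d S \<le> x)"
      using fin finT V ne by (simp add: steiner_diameter_def ecc Max_le_iff)
    also have "\<dots> \<longleftrightarrow> (\<forall>S\<in>?T. ?d S \<le> x)"
    proof -
      have "\<exists>v\<in>pverts G. v \<in> S" if "S \<in> ?T" for S
      proof -
        have "S \<noteq> {}" using that k by auto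
        then show ?thesis using that by blast
      qed
      then show ?thesis by blast
    qed
    also have "\<dots> \<longleftrightarrow> Max (?d ` ?T) \<le> x"
      using finT T_ne by (simp add: Max_le_iff)
    finally show ?thesis .
  qed
  show ?thesis by (rule order_antisym) (use le_iff in auto)
qed

text \<open>All distances of triples are at least 2, so the maximum is 2 exactly when each of them
  is at most 2.\<close>

lemma steiner_diameter_three_eq_two_iff:
  assumes G: "pair_graph G" and n: "3 \<le> card (pverts G)"
  shows "steiner_diameter G 3 = 2 \<longleftrightarrow>
    (\<forall>S. S \<subseteq> pverts G \<and> card S = 3 \<longrightarrow> (\<exists>y\<in>S. \<forall>w\<in>S - {y}. (y, w) \<in> parcs G))"
    (is "_ \<longleftrightarrow> ?R")
proof -
  interpret pair_graph G by (rule G)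
  let ?T = "{S. S \<subseteq> pverts G \<and> card S = 3}"
  have fin: "finite (steiner_distance G ` ?T)" using pair_finite_verts by simp
  obtain S where S: "S \<in> ?T"
    using obtain_subset_with_card_n[OF n] by blast
  have "2 \<le> Max (steiner_distance G ` ?T)"
    using S fin steiner_distance_three_ge[of S G] by (subst Max_ge_iff) auto
  then have "steiner_diameter G 3 = 2 \<longleftrightarrow> Max (steiner_distance G ` ?T) \<le> 2"
    using steiner_diameter_eq[OF pair_finite_verts _ n] by auto
  also have "\<dots> \<longleftrightarrow> (\<forall>S\<in>?T. steiner_distance G S \<le> 2)"
    using S fin by (subst Max_le_iff) auto
  also have "\<dots> \<longleftrightarrow> ?R"
    using steiner_distance_three_le_iff[OF G] by auto
  finally show ?thesis .
qed

section \<open>Degrees in a graph and its complement\<close>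

lemma degree_eq: "degree G v = card {w. (v, w) \<in> parcs G}"
proof -
  have "out_arcs (with_proj G) v = Pair v ` {w. (v, w) \<in> parcs G}"
    by (auto simp: out_arcs_def)
  then show ?thesis
    by (simp add: degree_def out_degree_def card_image inj_on_def)
qed

lemma degree_complement:
  assumes G: "pair_graph G" and v: "v \<in> pverts G"
  shows "degree G v + degree (complement G) v = card (pverts G) - 1"
proof -
  interpret pair_graph G by (rule G)
  let ?N = "{w. (v, w) \<in> parcs G}" and ?M = "{w. (v, w) \<in> parcs (complement G)}"
  have un: "?N \<union> ?M = pverts G - {v}" and dis: "?N \<inter> ?M = {}"
    using v no_loops' in_arcsD2 by (auto simp: complement_def)
  have "finite (?N \<union> ?M)" unfolding un using pair_finite_verts by simp
  then have "card (?N \<union> ?M) = card ?N + card ?M"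
    using dis by (intro card_Un_disjoint) auto
  then show ?thesis
    using v by (simp add: un degree_eq)
qed

text \<open>A finite set has at most one element iff any two of its elements coincide. This
  pointwise form can be compared directly with the existence of centres in triples.\<close>

lemma max_degree_complement_le_one_iff:
  assumes G: "pair_graph G" and V: "pverts G \<noteq> {}"
  shows "max_degree (complement G) \<le> 1 \<longleftrightarrow>
    (\<forall>v\<in>pverts G. \<forall>a\<in>pverts G - {v}. \<forall>b\<in>pverts G - {v}.
       (v, a) \<notin> parcs G \<and> (v, b) \<notin> parcs G \<longrightarrow> a = b)"
proof -
  interpret pair_graph G by (rule G)
  have "degree (complement G) v \<le> 1 \<longleftrightarrow>
      (\<forall>a\<in>pverts G - {v}. \<forall>b\<in>pverts G - {v}. (v, a) \<notin> parcs G \<and> (v, b) \<notin> parcs G \<longrightarrow> a = b)"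
    if "v \<in> pverts G" for v
  proof -
    have "finite {w. (v, w) \<in> parcs (complement G)}"
      by (rule finite_subset[OF _ pair_finite_verts]) (auto simp: complement_def)
    then show ?thesis
      using that by (simp add: degree_eq card_le_Suc0_iff_eq) (auto simp: complement_def)
  qed
  moreover have "max_degree (complement G) \<le> 1 \<longleftrightarrow> (\<forall>v\<in>pverts G. degree (complement G) v \<le> 1)"
    using V pair_finite_verts by (simp add: max_degree_def complement_def)
  ultimately show ?thesis by simp
qed

section \<open>Equivalence of the three conditions\<close>

theorem theorem2:
  fixes G :: "'a pair_pre_digraph" and n :: nat
  assumes "pair_graph G"
    and "Digraph_Component.connected (with_proj G)"
    and "card (pverts G) = n"
    and "n \<ge> 3"
  shows "(steiner_diameter G 3 = 2 \<longleftrightarrow> 0 \<le> max_degree (complement G) \<and> max_degree (complement G) \<le> 1)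
       \<and> (0 \<le> max_degree (complement G) \<and> max_degree (complement G) \<le> 1
            \<longleftrightarrow> n - 2 \<le> min_degree G \<and> min_degree G \<le> n - 1)"
proof -
  interpret pair_graph G by (rule assms)
  have V: "pverts G \<noteq> {}" using assms by auto
  let ?center = "\<forall>S. S \<subseteq> pverts G \<and> card S = 3 \<longrightarrow> (\<exists>y\<in>S. \<forall>w\<in>S - {y}. (y, w) \<in> parcs G)"
  let ?unique = "\<forall>v\<in>pverts G. \<forall>a\<in>pverts G - {v}. \<forall>b\<in>pverts G - {v}.
       (v, a) \<notin> parcs G \<and> (v, b) \<notin> parcs G \<longrightarrow> a = b"
  have "?center \<longleftrightarrow> ?unique"
  proof
    assume c: ?center
    show ?unique
    proof (intro ballI impI, rule ccontr)
      fix v a b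
      assume v: "v \<in> pverts G" and a: "a \<in> pverts G - {v}" and b: "b \<in> pverts G - {v}"
        and non: "(v, a) \<notin> parcs G \<and> (v, b) \<notin> parcs G" and "a \<noteq> b"
      \<comment> \<open>This triple has no centre: \<open>v\<close> misses \<open>a\<close> and
        \<open>b\<close>, and by symmetry each of those misses \<open>v\<close>.\<close>
      then have "{v, a, b} \<subseteq> pverts G" "card {v, a, b} = 3" by auto
      with c obtain y where "y \<in> {v, a, b}" "\<forall>w\<in>{v, a, b} - {y}. (y, w) \<in> parcs G" by blast
      then show False using non a b arcs_symmetric by auto
    qed
  next
    assume u: ?unique
    show ?center
    proof (intro allI impI)
      fix S assume S: "S \<subseteq> pverts G \<and> card S = 3"
      then obtain a b c where abc: "S = {a, b, c}" "a \<noteq> b" "b \<noteq> c" "a \<noteq> c"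
        by (auto simp: card_3_iff)
      have one: "(x, y) \<in> parcs G \<or> (x, z) \<in> parcs G"
        if "x \<in> S" "y \<in> S" "z \<in> S" "x \<noteq> y" "x \<noteq> z" "y \<noteq> z" for x y z
        using u that S by blast
      \<comment> \<open>No vertex of the triple is isolated in it, so at least two of its three
        pairs are edges; two such edges share a vertex, which is the centre.\<close>
      have "(a, b) \<in> parcs G \<or> (a, c) \<in> parcs G" "(b, a) \<in> parcs G \<or> (b, c) \<in> parcs G"
        "(c, a) \<in> parcs G \<or> (c, b) \<in> parcs G"
        by (rule one; use abc in auto)+
      then show "\<exists>y\<in>S. \<forall>w\<in>S - {y}. (y, w) \<in> parcs G"
        using abc arcs_symmetric by auto
    qed
  qed
  then have "steiner_diameter G 3 = 2 \<longleftrightarrow> max_degree (complement G) \<le> 1"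
    using steiner_diameter_three_eq_two_iff[OF assms(1)] max_degree_complement_le_one_iff[OF assms(1) V]
      assms(3,4) by simp
  moreover have "max_degree (complement G) \<le> 1 \<longleftrightarrow> n - 2 \<le> min_degree G"
  proof -
    have "max_degree (complement G) \<le> 1 \<longleftrightarrow> (\<forall>v\<in>pverts G. degree (complement G) v \<le> 1)"
      using V pair_finite_verts by (simp add: max_degree_def complement_def)
    \<comment> \<open>The two degrees of a vertex sum to \<open>n - 1\<close>; as \<open>n\<close>
      is at least 3, the subtractions on naturals do not truncate.\<close>
    also have "\<dots> \<longleftrightarrow> (\<forall>v\<in>pverts G. n - 2 \<le> degree G v)"
    proof (rule ball_cong[OF refl])
      fix v assume "v \<in> pverts G"
      then show "degree (complement G) v \<le> 1 \<longleftrightarrow> n - 2 \<le> degree G v"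
        using degree_complement[OF assms(1), of v] assms(3,4) by linarith
    qed
    also have "\<dots> \<longleftrightarrow> n - 2 \<le> min_degree G"
      using V pair_finite_verts by (simp add: min_degree_def)
    finally show ?thesis .
  qed
  \<comment> \<open>The upper bound in the third condition: any vertex has degree at most
    \<open>n - 1\<close> by the same sum.\<close>
  moreover have "min_degree G \<le> n - 1"
  proof -
    obtain v where v: "v \<in> pverts G" using V by auto
    have "min_degree G \<le> degree G v"
      using v pair_finite_verts by (simp add: min_degree_def)
    then show ?thesis using degree_complement[OF assms(1) v] assms(3) by linarith
  qed
  ultimately show ?thesis by simp
qed

end
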